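(* Let $X$ be a nonempty set, $d$ a partial metric on $X$, and $e(x,y)=2d(x,y)-d(x,x)-d(y,y)$ its associated metric; assume that $(X,e)$ is complete. Let $T:X\to X$ be a map, and suppose there is a right limit normal function $\varphi:\mathbb{R}_+\to\mathbb{R}_+$ such that $$d(Tx,Ty)\le \max\{\varphi(M(x,y)),\,c(x,y)\}\quad\text{for all }x,y\in X,$$ where $c(x,y)=\max\{d(x,x),d(y,y)\}$. Then for each $x\in X$: (i) the sequence $(\rho_n(x):=d(T^nx,T^{n+1}x);\ n\ge 0)$ is descending (nonincreasing), hence $\rho_n(x)\downarrow\gamma(x)$ for some $\gamma(x)\in\mathbb{R}_+$; (ii) $(\alpha_n(x):=d(T^nx,T^nx);\ n\ge 0)\searrow\gamma(x)$, so that $(T^nx;\ n\ge 0)$ is $e$-semi-Cauchy; (iii) $(\delta_{m,n}(x):=d(T^mx,T^nx);\ m,n\ge 0)\searrow\gamma(x)$, whence $(T^nx;\ n\ge 0)$ is $e$-Cauchy (i.e. Cauchy in the metric space $(X,e)$); (iv) the limit $x^*$ of $(T^nx;\ n\ge0)$ in the metric space $(X,e)$ exists and satisfies $d(x^*,Tx^* )=d(x^*,x^* )$. In particular, $T$ is a $d$-Picard operator.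
   Context: $\mathbb{R}_+=[0,\infty[$. A partial metric on $X$ is a map $d:X\times X\to\mathbb{R}_+$ such that for all $x,y,z\in X$: $d(x,y)=d(y,x)$; $d(x,z)\le d(x,y)+d(y,z)-d(y,y)$; $\max\{d(x,x),d(y,y)\}\le d(x,y)$; and $d(x,y)=d(x,x)=d(y,y)$ implies $x=y$. The function $e(x,y)=2d(x,y)-d(x,x)-d(y,y)$ is then a (standard) metric on $X$. For $x,y\in X$ put $M_1(x,y)=\max\{d(x,y),d(x,Tx),d(y,Ty)\}$, $M_2(x,y)=\tfrac12[d(x,Ty)+d(Tx,y)]$, and $M(x,y)=\max\{M_1(x,y),M_2(x,y)\}$. A function $\varphi:\mathbb{R}_+\to\mathbb{R}_+$ is normal if $\varphi(0)=0$ and $\varphi(t)<t$ for all $t>0$. It is right limit normal if it is normal and $\limsup_{t\to s+}\varphi(t)<s$ for all $s>0$, where $\limsup_{t\to s+}\varphi(t)=\inf_{\varepsilon>0}\sup\{\varphi(t);\ s\le t<s+\varepsilon\}$. For a real sequence $(\tau_n;\ n\ge n_0)$ and $\tau\in\mathbb{R}$: $(\tau_n;\ n\ge n_0)\downarrow\tau$ means $\tau_n\ge\tau$ for all $n\ge n_0$ and $\tau_n\to\tau$ (monotonicity is not required); $(\tau_n)\searrow\tau$ means $(\tau_n;\ n\ge k)\downarrow\tau$ for some $k\ge n_0$. Likewise for a doubly indexed real sequence, $\sigma_{m,n}\searrow\sigma$ means that for some $k$ one has $\sigma_{m,n}\ge\sigma$ for all $m,n\ge k$ and $\sigma_{m,n}\to\sigma$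 as $m,n\to\infty$. A sequence $(x_n)$ in $X$ is $e$-semi-Cauchy if there is $\gamma\in\mathbb{R}_+$ with $d(x_n,x_n)\searrow\gamma$ and $d(x_n,x_{n+1})\searrow\gamma$. $T$ is a $d$-Picard operator if for every $x\in X$ the sequence $(T^nx;\ n\ge0)$ converges in $(X,e)$ and its limit $x^*$ satisfies $d(x^*,Tx^* )=d(x^*,x^* )$. *)

theory Defs
  imports "HOL-Analysis.Analysis"
begin

locale Partial_metric_space =
  fixes X :: "'a set" and d :: "'a \<Rightarrow> 'a \<Rightarrow> real"
  assumes nonneg: "\<And>x y. \<lbrakk>x \<in> X; y \<in> X\<rbrakk> \<Longrightarrow> 0 \<le> d x y"
    and commute: "\<And>x y. \<lbrakk>x \<in> X; y \<in> X\<rbrakk> \<Longrightarrow> d x y = d y x"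
    and triangle: "\<And>x y z. \<lbrakk>x \<in> X; y \<in> X; z \<in> X\<rbrakk> \<Longrightarrow> d x z \<le> d x y + d y z - d y y"
    and self_le: "\<And>x y. \<lbrakk>x \<in> X; y \<in> X\<rbrakk> \<Longrightarrow> max (d x x) (d y y) \<le> d x y"
    and eqI: "\<And>x y. \<lbrakk>x \<in> X; y \<in> X; d x y = d x x; d x x = d y y\<rbrakk> \<Longrightarrow> x = y"

text \<open>
  The locale \<^locale>\<open>Metric_space\<close> requires nonnegativity and symmetry on the
  whole type, while a partial metric is constrained on the carrier only.  The associated metric
  is therefore set to 0 outside the carrier; this affects neither the topology nor the Cauchy
  sequences of the metric space.
\<close>

definition assoc_metric :: "'a set \<Rightarrow> ('a \<Rightarrow> 'a \<Rightarrow> real) \<Rightarrow> 'a \<Rightarrow> 'a \<Rightarrow> real" where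
  "assoc_metric X d x y = (if x \<in> X \<and> y \<in> X then 2 * d x y - d x x - d y y else 0)"

lemma (in Partial_metric_space) Metric_space_assoc_metric: "Metric_space X (assoc_metric X d)"
proof
  fix x y
  show "0 \<le> assoc_metric X d x y"
    using self_le[of x y] by (auto simp: assoc_metric_def)
  show "assoc_metric X d x y = assoc_metric X d y x"
    using commute[of x y] by (auto simp: assoc_metric_def)
next
  fix x y assume xy: "x \<in> X" "y \<in> X"
  show "assoc_metric X d x y = 0 \<longleftrightarrow> x = y"
  proof
    assume "assoc_metric X d x y = 0"
    then have "d x y = d x x" "d x x = d y y"
      using self_le[OF xy] xy by (auto simp: assoc_metric_def)
    then show "x = y" using eqI xy by blast
  qed (use xy in \<open>auto simp: assoc_metric_def\<close>)
next
  fix x y z assume "x \<in> X" "y \<in> X" "z \<in> X"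
  then show "assoc_metric X d x z \<le> assoc_metric X d x y + assoc_metric X d y z"
    using triangle[of x y z] by (auto simp: assoc_metric_def)
qed

definition M1 :: "('a \<Rightarrow> 'a \<Rightarrow> real) \<Rightarrow> ('a \<Rightarrow> 'a) \<Rightarrow> 'a \<Rightarrow> 'a \<Rightarrow> real" where
  "M1 d T x y = max (d x y) (max (d x (T x)) (d y (T y)))"

definition M2 :: "('a \<Rightarrow> 'a \<Rightarrow> real) \<Rightarrow> ('a \<Rightarrow> 'a) \<Rightarrow> 'a \<Rightarrow> 'a \<Rightarrow> real" where
  "M2 d T x y = (d x (T y) + d (T x) y) / 2"

definition M :: "('a \<Rightarrow> 'a \<Rightarrow> real) \<Rightarrow> ('a \<Rightarrow> 'a) \<Rightarrow> 'a \<Rightarrow> 'a \<Rightarrow> real" where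
  "M d T x y = max (M1 d T x y) (M2 d T x y)"

definition max_self :: "('a \<Rightarrow> 'a \<Rightarrow> real) \<Rightarrow> 'a \<Rightarrow> 'a \<Rightarrow> real" where
  "max_self d x y = max (d x x) (d y y)"

text \<open>Only the values of \<open>\<phi>\<close> on \<open>{0..}\<close> matter.\<close>

definition normal_fun :: "(real \<Rightarrow> real) \<Rightarrow> bool" where
  "normal_fun \<phi> \<longleftrightarrow> \<phi> \<in> {0..} \<rightarrow> {0..} \<and> \<phi> 0 = 0 \<and> (\<forall>t>0. \<phi> t < t)"

text \<open>
  The point \<open>t = s\<close> is included.  For normal \<open>\<phi>\<close> and \<open>s > 0\<close> the sets involved are nonempty and
  contained in \<open>{0..s + \<epsilon>}\<close>, so that the real-valued supremum and infimum are the true ones.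
\<close>

definition right_limsup :: "(real \<Rightarrow> real) \<Rightarrow> real \<Rightarrow> real" where
  "right_limsup \<phi> s = (INF \<epsilon>\<in>{0<..}. SUP t\<in>{s..<s + \<epsilon>}. \<phi> t)"

definition right_limit_normal :: "(real \<Rightarrow> real) \<Rightarrow> bool" where
  "right_limit_normal \<phi> \<longleftrightarrow> normal_fun \<phi> \<and> (\<forall>s>0. right_limsup \<phi> s < s)"

text \<open>
  Convergence from above, from the index \<open>n0\<close> on or eventually; no monotonicity is required.
\<close>

definition conv_above_from :: "nat \<Rightarrow> (nat \<Rightarrow> real) \<Rightarrow> real \<Rightarrow> bool" where
  "conv_above_from n0 \<tau> t \<longleftrightarrow> (\<forall>n\<ge>n0. t \<le> \<tau> n) \<and> \<tau> \<longlonglongrightarrow> t"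

definition ev_conv_above_from :: "nat \<Rightarrow> (nat \<Rightarrow> real) \<Rightarrow> real \<Rightarrow> bool" where
  "ev_conv_above_from n0 \<tau> t \<longleftrightarrow> (\<exists>k\<ge>n0. conv_above_from k \<tau> t)"

definition ev_conv_above2 :: "(nat \<Rightarrow> nat \<Rightarrow> real) \<Rightarrow> real \<Rightarrow> bool" where
  "ev_conv_above2 \<sigma> s \<longleftrightarrow>
     (\<exists>k. \<forall>m\<ge>k. \<forall>n\<ge>k. s \<le> \<sigma> m n) \<and>
     ((\<lambda>(m, n). \<sigma> m n) \<longlongrightarrow> s) (sequentially \<times>\<^sub>F sequentially)"

definition semi_Cauchy :: "('a \<Rightarrow> 'a \<Rightarrow> real) \<Rightarrow> (nat \<Rightarrow> 'a) \<Rightarrow> bool" where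
  "semi_Cauchy d x \<longleftrightarrow> (\<exists>\<gamma>\<ge>0.
     ev_conv_above_from 0 (\<lambda>n. d (x n) (x n)) \<gamma> \<and>
     ev_conv_above_from 0 (\<lambda>n. d (x n) (x (Suc n))) \<gamma>)"

definition Picard_operator :: "'a set \<Rightarrow> ('a \<Rightarrow> 'a \<Rightarrow> real) \<Rightarrow> ('a \<Rightarrow> 'a) \<Rightarrow> bool" where
  "Picard_operator X d T \<longleftrightarrow> (\<forall>x\<in>X. \<exists>z.
     limitin (Metric_space.mtopology X (assoc_metric X d)) (\<lambda>n. (T ^^ n) x) z sequentially \<and>
     d z (T z) = d z z)"

end

theory Submission
  imports Defs
begin

text \<open>
  Along an orbit \<open>x\<^sub>n\<close> the contraction gives \<open>M(x\<^sub>n, x\<^sub>n\<^sub>+\<^sub>1) = \<rho>\<^sub>n\<close>, so \<open>\<rho>\<^sub>n\<close> decreases to some \<open>\<gamma>\<close>.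
  If \<open>\<gamma> > 0\<close>, right limit normality eventually makes \<open>\<phi>(\<rho>\<^sub>n) < \<gamma>\<close>, whence
  \<open>\<alpha>\<^sub>n\<^sub>+\<^sub>1 \<le> max {\<phi>(\<rho>\<^sub>n), \<alpha>\<^sub>n}\<close> would keep the self-distances below \<open>\<gamma>\<close> once they are, against
  \<open>\<gamma> \<le> max {\<alpha>\<^sub>n, \<alpha>\<^sub>n\<^sub>+\<^sub>1}\<close>. For \<open>s > \<gamma>\<close>, the first \<open>n > m\<close> with \<open>\<delta>\<^sub>m\<^sub>,\<^sub>n \<ge> s\<close> has \<open>M(x\<^sub>m, x\<^sub>n)\<close>
  slightly above \<open>s\<close>, where \<open>\<phi>\<close> is bounded by some \<open>q < s\<close>; so \<open>\<delta>\<^sub>m\<^sub>+\<^sub>1\<^sub>,\<^sub>n\<^sub>+\<^sub>1\<close>, and with it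
  \<open>\<delta>\<^sub>m\<^sub>,\<^sub>n\<close>, is below \<open>s\<close>, which is absurd. Finally, if \<open>d(z, Tz) > \<gamma>\<close> at the limit \<open>z\<close>, then
  \<open>M(x\<^sub>n, z) = d(z, Tz)\<close> eventually, and \<open>n \<rightarrow> \<infinity>\<close> in the contraction contradicts \<open>\<phi>(t) < t\<close>.
\<close>

section \<open>Bounds from right limit normality\<close>

lemma right_limit_normal_bound:
  assumes "right_limit_normal \<phi>" "s > 0"
  obtains \<epsilon> q where "\<epsilon> > 0" "q < s" "\<And>t. \<lbrakk>s \<le> t; t < s + \<epsilon>\<rbrakk> \<Longrightarrow> \<phi> t \<le> q"
proof -
  have "(INF \<epsilon>\<in>{0<..}. SUP t\<in>{s..<s + \<epsilon>}. \<phi> t) < s"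
    using assms by (auto simp: right_limit_normal_def right_limsup_def)
  then obtain \<epsilon> where \<epsilon>: "\<epsilon> > 0" "(SUP t\<in>{s..<s + \<epsilon>}. \<phi> t) < s"
    using cInf_lessD[of "(\<lambda>\<epsilon>. SUP t\<in>{s..<s + \<epsilon>}. \<phi> t) ` {0<..}" s] by auto
  have lt: "\<phi> t < t" if "t > 0" for t
    using assms that by (auto simp: right_limit_normal_def normal_fun_def)
  \<comment> \<open>Normality bounds \<open>\<phi>\<close> on the window, so the real supremum
    there, which serves as \<open>q\<close>, is an upper bound.\<close>
  have "\<phi> t \<le> s + \<epsilon>" if "t \<in> {s..<s + \<epsilon>}" for t
    using lt[of t] that assms by auto
  then have "bdd_above (\<phi> ` {s..<s + \<epsilon>})"
    by (intro bdd_aboveI2)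
  then have "\<phi> t \<le> (SUP t\<in>{s..<s + \<epsilon>}. \<phi> t)" if "s \<le> t" "t < s + \<epsilon>" for t
    using that by (intro cSUP_upper) auto
  with \<epsilon> show ?thesis using that by blast
qed

lemma tendsto_eventually_below:
  fixes f :: "nat \<Rightarrow> real"
  assumes "f \<longlonglongrightarrow> a" "a < b"
  obtains N where "\<And>n. n \<ge> N \<Longrightarrow> f n < b"
  using order_tendstoD(2)[OF assms] by (auto simp: eventually_sequentially)

section \<open>The orbit of a fixed starting point\<close>

locale contractive_orbit = Partial_metric_space X d for X :: "'a set" and d +
  fixes T :: "'a \<Rightarrow> 'a" and \<phi> :: "real \<Rightarrow> real" and x :: 'a
  assumes maps: "T \<in> X \<rightarrow> X"
    and rln: "right_limit_normal \<phi>"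
    and contr: "\<And>x y. \<lbrakk>x \<in> X; y \<in> X\<rbrakk> \<Longrightarrow>
      d (T x) (T y) \<le> max (\<phi> (M d T x y)) (max_self d x y)"
    and x_in: "x \<in> X"
begin

definition u :: "nat \<Rightarrow> 'a" where
  "u n = (T ^^ n) x"

definition \<rho> :: "nat \<Rightarrow> real" where
  "\<rho> n = d (u n) (u (Suc n))"

definition \<alpha> :: "nat \<Rightarrow> real" where
  "\<alpha> n = d (u n) (u n)"

definition \<gamma> :: real where
  "\<gamma> = Inf (range \<rho>)"

lemma T_in: "y \<in> X \<Longrightarrow> T y \<in> X"
  using maps by auto

lemma u_in [simp]: "u n \<in> X"
  by (induction n) (auto simp: u_def x_in T_in)

lemma T_u [simp]: "T (u n) = u (Suc n)"
  by (simp add: u_def)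

lemma \<phi>_less: "t > 0 \<Longrightarrow> \<phi> t < t"
  using rln by (auto simp: right_limit_normal_def normal_fun_def)

lemma self_le1: "\<lbrakk>y \<in> X; z \<in> X\<rbrakk> \<Longrightarrow> d y y \<le> d y z"
  and self_le2: "\<lbrakk>y \<in> X; z \<in> X\<rbrakk> \<Longrightarrow> d z z \<le> d y z"
  using self_le[of y z] by auto

section \<open>Distances between consecutive iterates\<close>

lemma \<alpha>_nonneg: "0 \<le> \<alpha> n"
  and \<rho>_nonneg: "0 \<le> \<rho> n"
  and \<alpha>_le_\<rho>: "\<alpha> n \<le> \<rho> n"
  and \<alpha>_Suc_le_\<rho>: "\<alpha> (Suc n) \<le> \<rho> n"
  by (simp_all add: \<alpha>_def \<rho>_def nonneg self_le1 self_le2)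

text \<open>The self-distance in \<open>M2\<close> cancels the one subtracted in the triangle
  inequality through \<open>u (Suc n)\<close>, so \<open>M2\<close> is at most the mean of
  \<open>\<rho> n\<close> and \<open>\<rho> (Suc n)\<close>.\<close>

lemma M_consecutive: "M d T (u n) (u (Suc n)) = max (\<rho> n) (\<rho> (Suc n))"
  using triangle[of "u n" "u (Suc n)" "u (Suc (Suc n))"]
  by (auto simp: M_def M1_def M2_def \<rho>_def)

text \<open>A strict increase would give \<open>M\<close> the positive value
  \<open>\<rho> (Suc n)\<close>; then \<open>\<phi>\<close> of it and the self-distances, which are
  at most \<open>\<rho> n\<close>, would all lie below \<open>\<rho> (Suc n)\<close>.\<close>

lemma \<rho>_Suc_le: "\<rho> (Suc n) \<le> \<rho> n"
proof (rule ccontr)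
  assume less: "\<not> \<rho> (Suc n) \<le> \<rho> n"
  then have "\<phi> (M d T (u n) (u (Suc n))) < \<rho> (Suc n)"
    using \<phi>_less[of "\<rho> (Suc n)"] \<rho>_nonneg[of n] by (simp add: M_consecutive)
  then show False
    using contr[of "u n" "u (Suc n)"] less \<alpha>_le_\<rho>[of n] \<alpha>_Suc_le_\<rho>[of n]
    by (simp add: max_self_def \<rho>_def \<alpha>_def max_def split: if_splits)
qed

lemma decseq_\<rho>: "decseq \<rho>"
  by (simp add: decseq_Suc_iff \<rho>_Suc_le)

lemma \<gamma>_le_\<rho>: "\<gamma> \<le> \<rho> n"
  unfolding \<gamma>_def by (intro cInf_lower bdd_belowI[of _ 0]) (auto simp: \<rho>_nonneg)

lemma \<gamma>_nonneg: "0 \<le> \<gamma>"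
  unfolding \<gamma>_def by (intro cInf_greatest) (auto simp: \<rho>_nonneg)

lemma \<rho>_tendsto: "\<rho> \<longlonglongrightarrow> \<gamma>"
  unfolding \<gamma>_def
  by (intro LIMSEQ_decseq_INF decseq_\<rho> bdd_belowI[of _ 0]) (auto simp: \<rho>_nonneg)

section \<open>Convergence of the self-distances\<close>

lemma \<rho>_Suc_le_max: "\<rho> (Suc n) \<le> max (\<phi> (\<rho> n)) (max (\<alpha> n) (\<alpha> (Suc n)))"
  using contr[of "u n" "u (Suc n)"] \<rho>_Suc_le[of n] M_consecutive[of n]
  by (simp add: max_self_def max_absorb1) (simp add: \<rho>_def \<alpha>_def)

text \<open>The contraction is applied to \<open>u n\<close> paired with itself, where
  \<open>M\<close> is \<open>\<rho> n\<close>.\<close>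

lemma \<alpha>_Suc_le_max: "\<alpha> (Suc n) \<le> max (\<phi> (\<rho> n)) (\<alpha> n)"
proof -
  have "M d T (u n) (u n) = \<rho> n"
    using \<alpha>_le_\<rho>[of n] commute[of "u n" "u (Suc n)"]
    by (simp add: M_def M1_def M2_def \<rho>_def \<alpha>_def)
  then show ?thesis
    using contr[of "u n" "u n"] by (simp add: max_self_def \<alpha>_def)
qed

lemma \<alpha>_eventually_ge: "\<exists>k. \<forall>n\<ge>k. \<gamma> \<le> \<alpha> n"
proof (cases "\<gamma> = 0")
  case False
  then have "\<gamma> > 0" using \<gamma>_nonneg by simp
  then obtain \<epsilon> q where \<epsilon>: "\<epsilon> > 0" "q < \<gamma>" "\<And>t. \<lbrakk>\<gamma> \<le> t; t < \<gamma> + \<epsilon>\<rbrakk> \<Longrightarrow> \<phi> t \<le> q"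
    using right_limit_normal_bound[OF rln] by metis
  obtain k where k: "\<And>n. n \<ge> k \<Longrightarrow> \<rho> n < \<gamma> + \<epsilon>"
    using tendsto_eventually_below[OF \<rho>_tendsto, of "\<gamma> + \<epsilon>"] \<epsilon>(1) by auto
  have \<phi>\<rho>: "\<phi> (\<rho> n) < \<gamma>" if "n \<ge> k" for n
    using \<epsilon>(3)[OF \<gamma>_le_\<rho> k[OF that]] \<epsilon>(2) by linarith
  \<comment> \<open>If \<open>\<alpha> n < \<gamma>\<close>, then
    \<open>\<alpha> (Suc n) < \<gamma>\<close> too, and \<open>\<rho>_Suc_le_max\<close> would force
    \<open>\<rho> (Suc n) < \<gamma>\<close>.\<close>
  have "\<gamma> \<le> \<alpha> n" if "n \<ge> k" for n
    using \<phi>\<rho>[OF that] \<rho>_Suc_le_max[of n] \<alpha>_Suc_le_max[of n] \<gamma>_le_\<rho>[of "Suc n"]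
    by (auto simp: max_def split: if_splits)
  then show ?thesis by blast
qed (auto simp: \<alpha>_nonneg)

lemma \<alpha>_tendsto: "\<alpha> \<longlonglongrightarrow> \<gamma>"
proof (rule tendsto_sandwich)
  show "eventually (\<lambda>n. \<gamma> \<le> \<alpha> n) sequentially"
    using \<alpha>_eventually_ge by (simp add: eventually_sequentially)
qed (auto simp: \<alpha>_le_\<rho> intro: \<rho>_tendsto)

section \<open>Double limit and Cauchy property\<close>

lemma \<delta>_eventually_less:
  assumes "\<gamma> < s"
  shows "\<exists>N. \<forall>m\<ge>N. \<forall>n\<ge>N. d (u m) (u n) < s"
proof -
  have "s > 0" using assms \<gamma>_nonneg by simp
  then obtain \<epsilon> q where \<epsilon>: "\<epsilon> > 0" "q < s" "\<And>t. \<lbrakk>s \<le> t; t < s + \<epsilon>\<rbrakk> \<Longrightarrow> \<phi> t \<le> q"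
    using right_limit_normal_bound[OF rln] by metis
  \<comment> \<open>The bound \<open>\<epsilon> / 3\<close> keeps \<open>M\<close> in the window of
    \<open>\<phi>\<close>. The other two ensure that \<open>q\<close> and
    \<open>\<gamma> + \<kappa>\<close>, the possible bounds after one contraction, stay below
    \<open>s\<close> when \<open>2 * \<kappa>\<close> is added.\<close>
  define \<kappa> where "\<kappa> = min (\<epsilon> / 3) (min ((s - q) / 3) ((s - \<gamma>) / 4))"
  have "\<kappa> \<le> \<epsilon> / 3" "\<kappa> \<le> (s - q) / 3" "\<kappa> \<le> (s - \<gamma>) / 4" and "\<kappa> > 0"
    unfolding \<kappa>_def using \<epsilon>(1,2) assms by (linarith, linarith, linarith, simp)
  then have \<kappa>: "\<kappa> > 0" "2 * \<kappa> < \<epsilon>" "2 * \<kappa> + q < s" "\<gamma> + 3 * \<kappa> < s"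
    using \<epsilon>(1,2) assms by (simp_all add: field_simps)
  obtain k1 where k1: "\<And>n. n \<ge> k1 \<Longrightarrow> \<rho> n < \<gamma> + \<kappa>"
    using tendsto_eventually_below[OF \<rho>_tendsto, of "\<gamma> + \<kappa>"] \<kappa>(1) by auto
  obtain k2 where k2: "\<And>n. n \<ge> k2 \<Longrightarrow> \<gamma> \<le> \<alpha> n"
    using \<alpha>_eventually_ge by blast
  define N where "N = max k1 k2"
  have \<rho>: "d (u n) (u (Suc n)) < \<gamma> + \<kappa>" and \<alpha>: "\<gamma> \<le> d (u n) (u n)" if "n \<ge> N" for n
    using k1[of n] k2[of n] that by (auto simp: N_def \<rho>_def \<alpha>_def)
  have extend: "d (u m) (u (Suc n)) < s"
    if mn: "N \<le> m" "N \<le> n" and IH: "d (u m) (u n) < s" for m n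
  proof (rule ccontr)
    assume ge: "\<not> d (u m) (u (Suc n)) < s"
    note facts = \<rho>[OF mn(1)] \<rho>[OF mn(2)] \<rho>[of "Suc n"] \<alpha>[OF mn(1)] \<alpha>[OF mn(2)]
      \<alpha>[of "Suc m"] \<alpha>[of "Suc n"] \<alpha>[of "Suc (Suc n)"]
    \<comment> \<open>An extra orbit step costs less than \<open>\<kappa>\<close>: the triangle
      inequality adds some \<open>\<rho>\<close> below \<open>\<gamma> + \<kappa>\<close> and
      subtracts an \<open>\<alpha>\<close> of at least \<open>\<gamma>\<close>.\<close>
    have 1: "d (u m) (u (Suc n)) < s + \<kappa>"
      using triangle[of "u m" "u n" "u (Suc n)"] IH facts mn by auto
    have 2: "d (u m) (u (Suc (Suc n))) < s + 2 * \<kappa>"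
      using triangle[of "u m" "u (Suc n)" "u (Suc (Suc n))"] 1 facts mn by auto
    have 3: "d (u (Suc m)) (u (Suc n)) < s + 2 * \<kappa>"
      using triangle[of "u (Suc m)" "u m" "u (Suc n)"] commute[of "u (Suc m)" "u m"] 1 facts mn
      by auto
    have "s \<le> M d T (u m) (u (Suc n))" "M d T (u m) (u (Suc n)) < s + \<epsilon>"
      using ge 1 2 3 facts mn \<kappa> by (auto simp: M_def M1_def M2_def)
    from \<epsilon>(3)[OF this]
    have "d (u (Suc m)) (u (Suc (Suc n))) \<le> max q (\<gamma> + \<kappa>)"
      using contr[of "u m" "u (Suc n)"] facts mn
        self_le1[of "u m" "u (Suc m)"] self_le1[of "u (Suc n)" "u (Suc (Suc n))"]
      by (auto simp: max_self_def)
    \<comment> \<open>Two triangle inequalities lead back from the contracted pair, again at a cost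
      below \<open>\<kappa>\<close> each.\<close>
    moreover have "d (u m) (u (Suc n)) \<le> d (u m) (u (Suc m)) + d (u (Suc m)) (u (Suc (Suc n)))
        + d (u (Suc n)) (u (Suc (Suc n))) - d (u (Suc m)) (u (Suc m))
        - d (u (Suc (Suc n))) (u (Suc (Suc n)))"
      using triangle[of "u m" "u (Suc m)" "u (Suc n)"]
        triangle[of "u (Suc m)" "u (Suc (Suc n))" "u (Suc n)"]
        commute[of "u (Suc n)" "u (Suc (Suc n))"] by auto
    ultimately show False
      using ge facts mn \<kappa> by auto
  qed
  have le: "d (u m) (u n) < s" if "N \<le> m" "m \<le> n" for m n
    using that(2)
  proof (induction n rule: dec_induct)
    case base
    then show ?case
      using \<rho>[OF that(1)] self_le1[of "u m" "u (Suc m)"] \<kappa> by simp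
  next
    case (step n)
    then show ?case
      using \<open>N \<le> m\<close> by (intro extend) auto
  qed
  have "d (u m) (u n) < s" if "N \<le> m" "N \<le> n" for m n
    using le[of m n] le[of n m] commute[of "u m" "u n"] that by (cases "m \<le> n") auto
  then show ?thesis by blast
qed

lemma \<delta>_ev_conv_above2: "ev_conv_above2 (\<lambda>m n. d (u m) (u n)) \<gamma>"
proof -
  obtain k where k: "\<And>n. n \<ge> k \<Longrightarrow> \<gamma> \<le> \<alpha> n"
    using \<alpha>_eventually_ge by blast
  have ge: "\<gamma> \<le> d (u m) (u n)" if "m \<ge> k" for m n
    using k[OF that] self_le1[of "u m" "u n"] by (simp add: \<alpha>_def)
  have "((\<lambda>(m, n). d (u m) (u n)) \<longlongrightarrow> \<gamma>) (sequentially \<times>\<^sub>F sequentially)"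
  proof (rule order_tendstoI)
    fix s assume "s < \<gamma>"
    then have "s < d (u m) (u n)" if "m \<ge> k" for m n
      using ge[OF that, of n] by simp
    then show "eventually (\<lambda>p. s < (case p of (m, n) \<Rightarrow> d (u m) (u n))) (sequentially \<times>\<^sub>F sequentially)"
      by (auto simp: eventually_prod_sequentially intro!: exI[of _ k])
  next
    fix s assume "\<gamma> < s"
    then show "eventually (\<lambda>p. (case p of (m, n) \<Rightarrow> d (u m) (u n)) < s) (sequentially \<times>\<^sub>F sequentially)"
      using \<delta>_eventually_less[of s] by (simp add: eventually_prod_sequentially) blast
  qed
  with ge show ?thesis by (auto simp: ev_conv_above2_def)
qed

text \<open>Self-distances are eventually at least \<open>\<gamma>\<close>, so a distance below
  \<open>\<gamma> + \<epsilon> / 2\<close> makes the associated metric less than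
  \<open>\<epsilon>\<close>.\<close>

lemma MCauchy_u: "Metric_space.MCauchy X (assoc_metric X d) u"
  unfolding Metric_space.MCauchy_def[OF Metric_space_assoc_metric]
proof (intro conjI allI impI)
  fix \<epsilon> :: real assume "\<epsilon> > 0"
  then obtain N1 where N1: "\<And>m n. \<lbrakk>m \<ge> N1; n \<ge> N1\<rbrakk> \<Longrightarrow> d (u m) (u n) < \<gamma> + \<epsilon> / 2"
    using \<delta>_eventually_less[of "\<gamma> + \<epsilon> / 2"] by auto
  obtain k where k: "\<And>n. n \<ge> k \<Longrightarrow> \<gamma> \<le> \<alpha> n"
    using \<alpha>_eventually_ge by blast
  have "assoc_metric X d (u m) (u n) < \<epsilon>" if "max N1 k \<le> m" "max N1 k \<le> n" for m n
    using N1[of m n] k[of m] k[of n] that by (simp add: assoc_metric_def \<alpha>_def)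
  then show "\<exists>N. \<forall>m n. N \<le> m \<longrightarrow> N \<le> n \<longrightarrow> assoc_metric X d (u m) (u n) < \<epsilon>"
    by blast
qed auto

section \<open>The limit of the orbit\<close>

lemma limit_fixed_distance:
  assumes lim: "limitin (Metric_space.mtopology X (assoc_metric X d)) u z sequentially"
  shows "d z (T z) = d z z"
proof -
  interpret e: Metric_space X "assoc_metric X d" by (rule Metric_space_assoc_metric)
  have z: "z \<in> X" and "(\<lambda>n. assoc_metric X d (u n) z) \<longlonglongrightarrow> 0"
    using lim by (auto simp: e.limitin_metric_dist_null)
  then have e0: "(\<lambda>n. 2 * d (u n) z - \<alpha> n - d z z) \<longlonglongrightarrow> 0"
    by (simp add: assoc_metric_def \<alpha>_def)
  \<comment> \<open>The term lies between 0 and the associated metric, which exceeds it by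
    \<open>d (u n) z - d z z\<close>, a nonnegative quantity.\<close>
  have "(\<lambda>n. d (u n) z - \<alpha> n) \<longlonglongrightarrow> 0"
    by (rule tendsto_sandwich[OF _ _ tendsto_const e0])
      (use z self_le1[of "u _" z] self_le2[of "u _" z] in \<open>auto simp: \<alpha>_def intro!: always_eventually\<close>)
  from tendsto_add[OF this \<alpha>_tendsto] have uz: "(\<lambda>n. d (u n) z) \<longlonglongrightarrow> \<gamma>" by simp
  \<comment> \<open>Every term equals \<open>d z z\<close>, so uniqueness of limits yields its
    value.\<close>
  have "(\<lambda>n. 2 * d (u n) z - \<alpha> n - (2 * d (u n) z - \<alpha> n - d z z)) \<longlonglongrightarrow> 2 * \<gamma> - \<gamma> - 0"
    by (intro tendsto_intros uz \<alpha>_tendsto e0)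
  then have zz: "d z z = \<gamma>"
    by (simp add: LIMSEQ_const_iff)
  define L where "L = d z (T z)"
  have Tz: "T z \<in> X" using z T_in by blast
  have uTz: "(\<lambda>n. d (u n) (T z)) \<longlonglongrightarrow> L"
  proof (rule tendsto_sandwich)
    \<comment> \<open>The lower bound is the triangle inequality from \<open>z\<close> to
      \<open>T z\<close> through \<open>u n\<close>, the upper one that from \<open>u n\<close> to
      \<open>T z\<close> through \<open>z\<close>.\<close>
    have "(\<lambda>n. L + \<alpha> n - d (u n) z) \<longlonglongrightarrow> L + \<gamma> - \<gamma>"
      by (intro tendsto_intros uz \<alpha>_tendsto)
    then show "(\<lambda>n. L + \<alpha> n - d (u n) z) \<longlonglongrightarrow> L" by simp
    have "(\<lambda>n. d (u n) z + L - \<gamma>) \<longlonglongrightarrow> \<gamma> + L - \<gamma>"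
      by (intro tendsto_intros uz)
    then show "(\<lambda>n. d (u n) z + L - \<gamma>) \<longlonglongrightarrow> L" by simp
    have "L + \<alpha> n - d (u n) z \<le> d (u n) (T z)" for n
      using triangle[of z "u n" "T z"] commute[of z "u n"] z Tz by (simp add: L_def \<alpha>_def)
    then show "\<forall>\<^sub>F n in sequentially. L + \<alpha> n - d (u n) z \<le> d (u n) (T z)" by simp
    have "d (u n) (T z) \<le> d (u n) z + L - \<gamma>" for n
      using triangle[of "u n" z "T z"] z Tz zz by (simp add: L_def)
    then show "\<forall>\<^sub>F n in sequentially. d (u n) (T z) \<le> d (u n) z + L - \<gamma>" by simp
  qed
  have "L \<le> \<gamma>"
  proof (rule ccontr)
    assume "\<not> L \<le> \<gamma>"
    then have less: "\<gamma> < L" by simp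
    \<comment> \<open>\<open>M2\<close> tends to the mean of \<open>L\<close> and
      \<open>\<gamma>\<close>, so it is eventually below \<open>L\<close>.\<close>
    have "(\<lambda>n. (d (u n) (T z) + d (u (Suc n)) z) / 2) \<longlonglongrightarrow> (L + \<gamma>) / 2"
      by (intro tendsto_intros uTz LIMSEQ_Suc[OF uz]) auto
    then have "\<forall>\<^sub>F n in sequentially. (d (u n) (T z) + d (u (Suc n)) z) / 2 < L"
      using less by (elim order_tendstoD(2)) auto
    moreover have "\<forall>\<^sub>F n in sequentially. d (u n) z < L" "\<forall>\<^sub>F n in sequentially. \<rho> n < L"
      using less by (auto intro: order_tendstoD(2) uz \<rho>_tendsto)
    \<comment> \<open>\<open>M\<close> equals \<open>L\<close> exactly for large \<open>n\<close>,
      so \<open>\<phi>\<close> enters only through its value at \<open>L\<close> and no continuity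
      is involved.\<close>
    ultimately have "\<forall>\<^sub>F n in sequentially. M d T (u n) z = L"
    proof eventually_elim
      case (elim n)
      then show ?case by (simp add: M_def M1_def M2_def L_def \<rho>_def max_def)
    qed
    then have "\<forall>\<^sub>F n in sequentially. d (u (Suc n)) (T z) \<le> max (\<phi> L) (max (\<alpha> n) \<gamma>)"
    proof eventually_elim
      case (elim n)
      then show ?case using contr[of "u n" z] z zz by (simp add: max_self_def \<alpha>_def)
    qed
    moreover have "(\<lambda>n. max (\<phi> L) (max (\<alpha> n) \<gamma>)) \<longlonglongrightarrow> max (\<phi> L) (max \<gamma> \<gamma>)"
      by (intro tendsto_intros \<alpha>_tendsto)
    ultimately have "L \<le> max (\<phi> L) \<gamma>"
      using tendsto_le[OF _ _ LIMSEQ_Suc[OF uTz]] by (metis max.idem trivial_limit_sequentially)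
    then show False
      using \<phi>_less[of L] \<gamma>_nonneg less by auto
  qed
  then show ?thesis
    using self_le1[of z "T z"] z Tz zz by (simp add: L_def)
qed

end

theorem theorem1:
  fixes X :: "'a set" and d :: "'a \<Rightarrow> 'a \<Rightarrow> real"
    and T :: "'a \<Rightarrow> 'a" and \<phi> :: "real \<Rightarrow> real"
  assumes "X \<noteq> {}"
    and "Partial_metric_space X d"
    and "Metric_space.mcomplete X (assoc_metric X d)"
    and "T \<in> X \<rightarrow> X"
    and "right_limit_normal \<phi>"
    and "\<And>x y. \<lbrakk>x \<in> X; y \<in> X\<rbrakk> \<Longrightarrow> d (T x) (T y) \<le> max (\<phi> (M d T x y)) (max_self d x y)"
  shows "(\<forall>x\<in>X.
      (\<exists>\<gamma>\<ge>0.
        \<comment> \<open>(i)\<close>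
        decseq (\<lambda>n. d ((T ^^ n) x) ((T ^^ Suc n) x)) \<and>
        conv_above_from 0 (\<lambda>n. d ((T ^^ n) x) ((T ^^ Suc n) x)) \<gamma> \<and>
        \<comment> \<open>(ii)\<close>
        ev_conv_above_from 0 (\<lambda>n. d ((T ^^ n) x) ((T ^^ n) x)) \<gamma> \<and>
        semi_Cauchy d (\<lambda>n. (T ^^ n) x) \<and>
        \<comment> \<open>(iii)\<close>
        ev_conv_above2 (\<lambda>m n. d ((T ^^ m) x) ((T ^^ n) x)) \<gamma> \<and>
        Metric_space.MCauchy X (assoc_metric X d) (\<lambda>n. (T ^^ n) x)) \<and>
      \<comment> \<open>(iv)\<close>
      (\<exists>z. limitin (Metric_space.mtopology X (assoc_metric X d)) (\<lambda>n. (T ^^ n) x) z sequentially \<and>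
           d z (T z) = d z z)) \<and>
    Picard_operator X d T"
proof -
  have *: "(\<exists>\<gamma>\<ge>0.
        decseq (\<lambda>n. d ((T ^^ n) x) ((T ^^ Suc n) x)) \<and>
        conv_above_from 0 (\<lambda>n. d ((T ^^ n) x) ((T ^^ Suc n) x)) \<gamma> \<and>
        ev_conv_above_from 0 (\<lambda>n. d ((T ^^ n) x) ((T ^^ n) x)) \<gamma> \<and>
        semi_Cauchy d (\<lambda>n. (T ^^ n) x) \<and>
        ev_conv_above2 (\<lambda>m n. d ((T ^^ m) x) ((T ^^ n) x)) \<gamma> \<and>
        Metric_space.MCauchy X (assoc_metric X d) (\<lambda>n. (T ^^ n) x)) \<and>
      (\<exists>z. limitin (Metric_space.mtopology X (assoc_metric X d)) (\<lambda>n. (T ^^ n) x) z sequentially \<and>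
           d z (T z) = d z z)" if "x \<in> X" for x
  proof -
    interpret Partial_metric_space X d by fact
    interpret o: contractive_orbit X d T \<phi> x
      by unfold_locales (use assms that in auto)
    interpret e: Metric_space X "assoc_metric X d" by (rule Metric_space_assoc_metric)
    have \<rho>: "conv_above_from 0 (\<lambda>n. d (o.u n) (o.u (Suc n))) o.\<gamma>"
      using o.\<gamma>_le_\<rho> o.\<rho>_tendsto by (simp add: conv_above_from_def o.\<rho>_def[abs_def])
    have \<alpha>: "ev_conv_above_from 0 (\<lambda>n. d (o.u n) (o.u n)) o.\<gamma>"
      using o.\<alpha>_eventually_ge o.\<alpha>_tendsto
      by (simp add: ev_conv_above_from_def conv_above_from_def o.\<alpha>_def[abs_def])
    have semi: "semi_Cauchy d o.u"
      using \<rho> \<alpha> o.\<gamma>_nonneg by (auto simp: semi_Cauchy_def ev_conv_above_from_def)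
    have dec: "decseq (\<lambda>n. d (o.u n) (o.u (Suc n)))"
      using o.decseq_\<rho> by (simp add: o.\<rho>_def[abs_def])
    obtain z where z: "limitin e.mtopology o.u z sequentially"
      using o.MCauchy_u assms(3) by (auto simp: e.mcomplete_def)
    show ?thesis
      \<comment> \<open>Folding turns the iterates in the goal into \<open>o.u\<close>, the form of
        the collected facts.\<close>
      unfolding o.u_def[symmetric]
      using o.\<gamma>_nonneg dec \<rho> \<alpha> semi o.\<delta>_ev_conv_above2 o.MCauchy_u z o.limit_fixed_distance[OF z]
      by blast
  qed
  then show ?thesis
    by (auto simp: Picard_operator_def)
qed

end
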